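(* Let $n>k\geq 4$ be integers. Every $k$-critical graph $G$ on $n$ vertices satisfies $t_{k-1}(G)\leq n-k+3$.
   Context: All graphs are finite and simple. A graph $G$ is called $k$-critical if its chromatic number is $k$ but every proper subgraph of $G$ has chromatic number less than $k$. For a graph $G$ and a positive integer $\ell$, $t_\ell(G)$ denotes the number of copies of the complete graph $K_\ell$ (cliques on $\ell$ vertices) contained in $G$. *)

theory Defs
  imports "Graph_Theory.Graph_Theory"
begin

text \<open>
  Finite simple graphs are the models of the locale \<^locale>\<open>graph\<close>: finite, loopless symmetric
  digraphs without parallel arcs, every undirected edge being represented by its two orientations.
\<close>

definition proper_colouring :: "('a, 'b) pre_digraph \<Rightarrow> nat \<Rightarrow> ('a \<Rightarrow> nat) \<Rightarrow> bool" where
  "proper_colouring G m c \<longleftrightarrow>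
     c ` verts G \<subseteq> {..<m} \<and> (\<forall>u v. u \<rightarrow>\<^bsub>G\<^esub> v \<longrightarrow> c u \<noteq> c v)"

definition chromatic_number :: "('a, 'b) pre_digraph \<Rightarrow> nat" where
  "chromatic_number G = (LEAST m. \<exists>c. proper_colouring G m c)"

text \<open>
  \<^const>\<open>subgraph\<close> also relates non-symmetric subdigraphs, so \<^prop>\<open>graph H\<close> is needed for \<open>H\<close> to be an
  undirected subgraph. It forces \<open>H\<close> to have the same tail and head functions as \<open>G\<close>, so \<open>H \<noteq> G\<close>
  means that a vertex or an edge of \<open>G\<close> is missing in \<open>H\<close>.
\<close>

definition critical :: "nat \<Rightarrow> ('a, 'b) pre_digraph \<Rightarrow> bool" where
  "critical k G \<longleftrightarrow> graph G \<and> chromatic_number G = k \<and>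
     (\<forall>H. graph H \<and> subgraph H G \<and> H \<noteq> G \<longrightarrow> chromatic_number H < k)"

text \<open>\<^const>\<open>complete_digraph\<close> includes the requirement that \<open>H\<close> be a \<^const>\<open>graph\<close>.\<close>

definition clique_count :: "nat \<Rightarrow> ('a, 'b) pre_digraph \<Rightarrow> nat" where
  "clique_count l G = card {H. subgraph H G \<and> complete_digraph l H}"

end

(*
  Write h = k - 1 and let K range over the h-cliques of G. For weights a_K put
  f(Q) = (sum of a_K over K containing Q) and F = f({}). An h-colouring of G - xy gives x and y the
  same colour; its class C meets every K in one vertex, except in two if x and y are both in K.
  Hence f(R) + f(R + x + y) is the sum of f(R + w) over w in C, for every R. If f vanishes on
  singletons, this gives f = 0 on all sets by induction on the size, so all a_K vanish.

  To save k - 3 dimensions, it suffices to find P of size h - 2 such that f can vanish on all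
  vertices outside P only if it vanishes on P too.
  If some vertex v has degree h, take the neighbourhood of v minus two non-adjacent vertices: for an
  h-colouring of G - v, the class of every p in P meets every K exactly once, so f(p) = F, and
  h F = (sum of f over P) = (h - 2) F.
  If no vertex has degree h, take for P any clique of size h - 2: the identity above with R = {}
  gives f(pu) = f(p) - F for u outside P and f(pq) = f(p) + f(q) - F for q in P, and summing over the
  neighbours of p yields (deg p - h)(f(p) - F) = 0, so again f(p) = F.
*)
theory Submission
  imports Defs Complex_Main
begin

section \<open>Linear algebra: homogeneous systems with fewer equations than unknowns\<close>

text \<open>Gaussian elimination, by induction on the equations: an equation with a nonzero
  coefficient removes one unknown, and an equation whose coefficients all vanish is dropped.\<close>

lemma homogeneous_system_nontrivial:
  fixes c :: "'e \<Rightarrow> 's \<Rightarrow> real"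
  assumes "finite E" "finite S" "card E < card S"
  shows "\<exists>a. (\<exists>s\<in>S. a s \<noteq> 0) \<and> (\<forall>e\<in>E. (\<Sum>s\<in>S. c e s * a s) = 0)"
  using assms
proof (induction E arbitrary: S c rule: finite_induct)
  case empty
  then obtain s where "s \<in> S" by fastforce
  then show ?case by (intro exI[of _ "\<lambda>_. 1"]) auto
next
  case (insert e E)
  show ?case
  proof (cases "\<forall>s\<in>S. c e s = 0")
    case True
    from insert obtain a where "\<exists>s\<in>S. a s \<noteq> 0" "\<forall>e\<in>E. (\<Sum>s\<in>S. c e s * a s) = 0"
      by (metis card_insert_disjoint Suc_lessD)
    with True show ?thesis by (intro exI[of _ a]) auto
  next
    case False
    then obtain s0 where s0: "s0 \<in> S" "c e s0 \<noteq> 0" by blast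
    define S' where "S' = S - {s0}"
    have S: "S = insert s0 S'" "s0 \<notin> S'" "finite S'"
      using s0 insert.prems by (auto simp: S'_def)
    have "card E < card S'"
      using insert.prems insert.hyps S by simp
    \<comment> \<open>These are the coefficients left in equation \<open>i\<close> once equation
      \<open>e\<close> is solved for the pivot \<open>s0\<close> and substituted.\<close>
    from insert.IH[OF \<open>finite S'\<close> this, of "\<lambda>i s. c i s - c i s0 * c e s / c e s0"]
    obtain a where a: "\<exists>s\<in>S'. a s \<noteq> 0"
      "\<And>i. i \<in> E \<Longrightarrow> (\<Sum>s\<in>S'. (c i s - c i s0 * c e s / c e s0) * a s) = 0" by blast
    define b where "b = a(s0 := - (\<Sum>s\<in>S'. c e s * a s) / c e s0)"
    have b: "(\<Sum>s\<in>S. c i s * b s) = c i s0 * b s0 + (\<Sum>s\<in>S'. c i s * a s)" for i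
    proof -
      have "(\<Sum>s\<in>S'. c i s * b s) = (\<Sum>s\<in>S'. c i s * a s)"
        using S by (intro sum.cong) (auto simp: b_def)
      then show ?thesis using S by simp
    qed
    have "(\<Sum>s\<in>S. c i s * b s) = 0" if "i \<in> insert e E" for i
    proof (cases "i = e")
      case True
      then show ?thesis using s0 by (simp add: b) (simp add: b_def)
    next
      case False
      have "0 = (\<Sum>s\<in>S'. c i s * a s - c i s0 / c e s0 * (c e s * a s))"
        using a(2)[of i] that False by (simp add: algebra_simps)
      also have "\<dots> = (\<Sum>s\<in>S'. c i s * a s) - c i s0 / c e s0 * (\<Sum>s\<in>S'. c e s * a s)"
        by (simp add: sum_subtractf sum_distrib_left)
      finally show ?thesis by (simp add: b) (simp add: b_def)
    qed
    moreover have "\<exists>s\<in>S. b s \<noteq> 0"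
      using a(1) S by (auto simp: b_def)
    ultimately show ?thesis by blast
  qed
qed

section \<open>Clique weights and double counting\<close>

lemma card_fibre_eq_1:
  assumes "bij_betw c K I" "i \<in> I"
  shows "card {w \<in> K. c w = i} = 1"
proof -
  obtain w where w: "w \<in> K" "c w = i" using assms by (auto simp: bij_betw_def)
  then have "{w \<in> K. c w = i} = {w}"
    using assms by (auto simp: bij_betw_def inj_on_def)
  then show ?thesis by simp
qed

text \<open>Keeps what the counting needs from k-criticality, with \<open>h\<close> = k - 1:
  \<open>h\<close> colours suffice after deleting one edge or one vertex, but not for the whole
  graph.\<close>

locale critical_adjacency =
  fixes V :: "'a set" and adj :: "'a \<Rightarrow> 'a \<Rightarrow> bool" and h :: nat
  assumes finite_V: "finite V"
    and adj_in_V: "adj u v \<Longrightarrow> u \<in> V"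
    and adj_sym: "adj u v \<Longrightarrow> adj v u"
    and adj_irrefl: "\<not> adj u u"
    and edge_colouring: "adj x y \<Longrightarrow>
      \<exists>c. c ` V \<subseteq> {..<h} \<and> (\<forall>u v. adj u v \<longrightarrow> {u, v} \<noteq> {x, y} \<longrightarrow> c u \<noteq> c v)"
    and vertex_colouring: "z \<in> V \<Longrightarrow>
      \<exists>c. c ` (V - {z}) \<subseteq> {..<h} \<and> (\<forall>u v. adj u v \<longrightarrow> u \<noteq> z \<longrightarrow> v \<noteq> z \<longrightarrow> c u \<noteq> c v)"
    and not_colourable: "c ` V \<subseteq> {..<h} \<Longrightarrow> \<exists>u v. adj u v \<and> c u = c v"
begin

definition cliques :: "'a set set" where
  "cliques = {K. K \<subseteq> V \<and> card K = h \<and> (\<forall>u\<in>K. \<forall>v\<in>K. u \<noteq> v \<longrightarrow> adj u v)}"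

text \<open>This is f of the overview; \<open>weight a {}\<close> is the total F.\<close>

definition weight :: "('a set \<Rightarrow> real) \<Rightarrow> 'a set \<Rightarrow> real" where
  "weight a Q = (\<Sum>K | K \<in> cliques \<and> Q \<subseteq> K. a K)"

abbreviation neighbours :: "'a \<Rightarrow> 'a set" where
  "neighbours v \<equiv> {u. adj v u}"

lemma finite_cliques: "finite cliques"
  using finite_V by (auto simp: cliques_def)

lemma finite_clique: "K \<in> cliques \<Longrightarrow> finite K"
  using finite_V by (auto simp: cliques_def intro: finite_subset)

lemma neighbours_subset: "neighbours v \<subseteq> V - {v}"
  using adj_in_V adj_sym adj_irrefl by blast

lemma finite_neighbours: "finite (neighbours v)"
  using neighbours_subset finite_V by (meson finite_Diff finite_subset)

text \<open>Double counting of the pairs (w, K) with w in both K and \<open>C\<close>. It is used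
  with \<open>C\<close> the whole vertex set, a neighbourhood or a colour class, where the size of K
  \<inter> C is known.\<close>

lemma sum_weight_insert:
  assumes "finite C"
  shows "(\<Sum>w\<in>C. weight a (insert w R)) =
    (\<Sum>K | K \<in> cliques \<and> R \<subseteq> K. a K * real (card (K \<inter> C)))"
proof -
  let ?A = "{K. K \<in> cliques \<and> R \<subseteq> K}"
  have "(\<Sum>w\<in>C. weight a (insert w R)) = (\<Sum>w\<in>C. \<Sum>K\<in>?A. if w \<in> K then a K else 0)"
  proof (intro sum.cong refl)
    fix w
    have "(\<Sum>K\<in>?A. if w \<in> K then a K else 0) = (\<Sum>K\<in>{K\<in>?A. w \<in> K}. a K)"
      using finite_cliques by (subst sum.inter_filter) auto
    also have "{K\<in>?A. w \<in> K} = {K. K \<in> cliques \<and> insert w R \<subseteq> K}" by auto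
    finally show "weight a (insert w R) = (\<Sum>K\<in>?A. if w \<in> K then a K else 0)"
      by (simp add: weight_def)
  qed
  also have "\<dots> = (\<Sum>K\<in>?A. \<Sum>w\<in>C. if w \<in> K then a K else 0)"
    by (rule sum.swap)
  also have "\<dots> = (\<Sum>K\<in>?A. a K * real (card (K \<inter> C)))"
  proof (intro sum.cong refl)
    fix K
    have "(\<Sum>w\<in>C. if w \<in> K then a K else 0) = (\<Sum>w\<in>{w\<in>C. w \<in> K}. a K)"
      using assms by (simp only: sum.inter_filter)
    also have "{w\<in>C. w \<in> K} = K \<inter> C" by auto
    finally show "(\<Sum>w\<in>C. if w \<in> K then a K else 0) = a K * real (card (K \<inter> C))" by simp
  qed
  finally show ?thesis .
qed

lemma sum_weight_singletons: "(\<Sum>v\<in>V. weight a {v}) = real h * weight a {}"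
proof -
  have "(\<Sum>v\<in>V. weight a {v}) = (\<Sum>K | K \<in> cliques \<and> {} \<subseteq> K. a K * real (card (K \<inter> V)))"
    using sum_weight_insert[OF finite_V, of a "{}"] by simp
  also have "\<dots> = (\<Sum>K | K \<in> cliques \<and> {} \<subseteq> K. real h * a K)"
    by (intro sum.cong refl) (auto simp: cliques_def Int_absorb2)
  finally show ?thesis by (simp add: weight_def sum_distrib_left)
qed

lemma sum_weight_neighbours:
  "(\<Sum>u\<in>neighbours v. weight a {u, v}) = (real h - 1) * weight a {v}"
proof -
  have "(\<Sum>u\<in>neighbours v. weight a {u, v}) =
      (\<Sum>K | K \<in> cliques \<and> {v} \<subseteq> K. a K * real (card (K \<inter> neighbours v)))"
    by (rule sum_weight_insert[OF finite_neighbours])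
  also have "\<dots> = (\<Sum>K | K \<in> cliques \<and> {v} \<subseteq> K. (real h - 1) * a K)"
  proof (intro sum.cong refl)
    fix K assume K: "K \<in> {K. K \<in> cliques \<and> {v} \<subseteq> K}"
    then have "K \<inter> neighbours v = K - {v}"
      using adj_irrefl by (auto simp: cliques_def)
    moreover have "card K \<ge> 1"
      using K finite_clique by (metis (mono_tags) One_nat_def Suc_leI card_gt_0_iff empty_iff insert_subset mem_Collect_eq)
    ultimately have "real (card (K \<inter> neighbours v)) = real h - 1"
      using K finite_clique[of K] by (auto simp: cliques_def of_nat_diff)
    then show "a K * real (card (K \<inter> neighbours v)) = (real h - 1) * a K" by simp
  qed
  finally show ?thesis by (simp add: weight_def sum_distrib_left)
qed

section \<open>Colour classes after deleting an edge\<close>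

lemma rainbow_cliqueI:
  assumes "K \<in> cliques" "c ` K \<subseteq> {..<h}" "\<And>u v. u \<in> K \<Longrightarrow> v \<in> K \<Longrightarrow> u \<noteq> v \<Longrightarrow> c u \<noteq> c v"
  shows "bij_betw c K {..<h}"
proof -
  have inj: "inj_on c K" using assms(3) by (auto simp: inj_on_def)
  then have "card (c ` K) = card {..<h}"
    using assms(1) by (simp add: card_image cliques_def)
  then have "c ` K = {..<h}" using assms(2) by (intro card_subset_eq) auto
  with inj show ?thesis by (simp add: bij_betw_def)
qed

text \<open>\<open>C\<close> is the class of \<open>x\<close> in an \<open>h\<close>-colouring with
  the edge xy deleted. A clique that does not contain both ends keeps all its edges, so it shows
  each of the \<open>h\<close> colours exactly once.\<close>

lemma merged_colour_class:
  assumes "adj x y"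
  obtains C where "C \<subseteq> V" "x \<in> C" "y \<in> C"
    "\<And>u v. u \<in> C \<Longrightarrow> v \<in> C \<Longrightarrow> adj u v \<Longrightarrow> {u, v} = {x, y}"
    "\<And>K. K \<in> cliques \<Longrightarrow> card (K \<inter> C) = (if {x, y} \<subseteq> K then 2 else 1)"
proof -
  obtain c where c: "c ` V \<subseteq> {..<h}"
    "\<And>u v. adj u v \<Longrightarrow> {u, v} \<noteq> {x, y} \<Longrightarrow> c u \<noteq> c v"
    using edge_colouring[OF assms] by blast
  have xy: "x \<in> V" "y \<in> V" "x \<noteq> y"
    using assms adj_in_V adj_sym adj_irrefl by blast+
  \<comment> \<open>Some edge of the full graph is monochromatic, and only xy can be.\<close>
  have cxy: "c x = c y"
    using not_colourable[OF c(1)] c(2) by (metis doubleton_eq_iff)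
  define C where "C = {w \<in> V. c w = c x}"
  have C: "{u, v} = {x, y}" if "u \<in> C" "v \<in> C" "adj u v" for u v
    using c(2)[OF that(3)] that by (auto simp: C_def)
  have "card (K \<inter> C) = (if {x, y} \<subseteq> K then 2 else 1)" if K: "K \<in> cliques" for K
  proof (cases "{x, y} \<subseteq> K")
    case True
    \<comment> \<open>A third vertex of the clique in \<open>C\<close> would be adjacent to
      \<open>x\<close>, a second edge inside \<open>C\<close>.\<close>
    have "w = x \<or> w = y" if "w \<in> K" "w \<in> C" for w
    proof (rule ccontr)
      assume "\<not> (w = x \<or> w = y)"
      moreover from this have "adj w x" using K True that by (auto simp: cliques_def)
      ultimately show False using C[of w x] that xy by (auto simp: C_def doubleton_eq_iff)
    qed
    then have "K \<inter> C = {x, y}" using True xy cxy by (auto simp: C_def)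
    then show ?thesis using True xy by simp
  next
    case False
    have "bij_betw c K {..<h}"
    proof (rule rainbow_cliqueI[OF K])
      show "c ` K \<subseteq> {..<h}" using K c(1) by (auto simp: cliques_def)
      show "c u \<noteq> c v" if "u \<in> K" "v \<in> K" "u \<noteq> v" for u v
      proof -
        have "{u, v} \<noteq> {x, y}" using that False by auto
        then show ?thesis using c(2)[of u v] K that by (auto simp: cliques_def)
      qed
    qed
    moreover have "c x \<in> {..<h}" using c(1) xy by auto
    moreover have "K \<inter> C = {w \<in> K. c w = c x}" using K by (auto simp: C_def cliques_def)
    ultimately show ?thesis using False card_fibre_eq_1[of c K "{..<h}" "c x"] by auto
  qed
  with that[of C] C xy cxy show thesis by (auto simp: C_def)
qed

text \<open>The double count over \<open>C\<close> takes each clique containing \<open>R\<close>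
  once, and once more if it also contains \<open>x\<close> and \<open>y\<close>; the extra terms
  form the second weight.\<close>

lemma merged_class_weight:
  assumes "adj x y"
  obtains C where "C \<subseteq> V" "x \<in> C" "y \<in> C"
    "\<And>u v. u \<in> C \<Longrightarrow> v \<in> C \<Longrightarrow> adj u v \<Longrightarrow> {u, v} = {x, y}"
    "\<And>a R. (\<Sum>w\<in>C. weight a (insert w R)) = weight a R + weight a (R \<union> {x, y})"
proof -
  obtain C where C: "C \<subseteq> V" "x \<in> C" "y \<in> C"
    "\<And>u v. u \<in> C \<Longrightarrow> v \<in> C \<Longrightarrow> adj u v \<Longrightarrow> {u, v} = {x, y}"
    "\<And>K. K \<in> cliques \<Longrightarrow> card (K \<inter> C) = (if {x, y} \<subseteq> K then 2 else 1)"
    by (rule merged_colour_class[OF assms]) blast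
  have "(\<Sum>w\<in>C. weight a (insert w R)) = weight a R + weight a (R \<union> {x, y})" for a R
  proof -
    let ?A = "{K. K \<in> cliques \<and> R \<subseteq> K}"
    have "finite C" using C(1) finite_V by (rule finite_subset)
    then have "(\<Sum>w\<in>C. weight a (insert w R)) = (\<Sum>K\<in>?A. a K * real (card (K \<inter> C)))"
      by (rule sum_weight_insert)
    also have "\<dots> = (\<Sum>K\<in>?A. a K + (if {x, y} \<subseteq> K then a K else 0))"
      using C(5) by (intro sum.cong) auto
    also have "\<dots> = weight a R + (\<Sum>K\<in>{K\<in>?A. {x, y} \<subseteq> K}. a K)"
      unfolding sum.distrib weight_def
      using finite_cliques by (subst sum.inter_filter) auto
    also have "{K\<in>?A. {x, y} \<subseteq> K} = {K. K \<in> cliques \<and> R \<union> {x, y} \<subseteq> K}" by auto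
    finally show ?thesis by (simp add: weight_def)
  qed
  with that C show thesis by blast
qed

section \<open>Weights are determined by their values at vertices\<close>

text \<open>Induction on the size of \<open>Q\<close>: for two vertices of \<open>Q\<close> that are
  adjacent, the merged class identity expresses the weight of \<open>Q\<close> by weights of smaller
  sets. If they are not adjacent, no clique contains \<open>Q\<close>.\<close>

lemma weight_eq_0:
  assumes "h > 0" and "\<And>v. v \<in> V \<Longrightarrow> weight a {v} = 0" and "finite Q" "Q \<subseteq> V"
  shows "weight a Q = 0"
  using assms(3,4)
proof (induction "card Q" arbitrary: Q rule: less_induct)
  case less
  consider "Q = {}" | v where "Q = {v}" | x y where "x \<in> Q" "y \<in> Q" "x \<noteq> y" by blast
  then show ?case
  proof cases
    case 1
    \<comment> \<open>The vertex weights add up to \<open>h\<close> times the total, and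
      \<open>h > 0\<close>.\<close>
    then show ?thesis using sum_weight_singletons[of a] assms(1,2) by simp
  next
    case 2
    then show ?thesis using assms(2) less.prems by simp
  next
    case 3
    show ?thesis
    proof (cases "adj x y")
      case False
      then have "{K. K \<in> cliques \<and> Q \<subseteq> K} = {}" using 3 by (auto simp: cliques_def)
      then show ?thesis by (simp only: weight_def sum.empty)
    next
      case True
      define R where "R = Q - {x, y}"
      have R: "Q = R \<union> {x, y}" "finite R" "R \<subseteq> V" "card Q = card R + 2"
        using 3 less.prems card_Diff_subset[of "{x, y}" Q] card_mono[of Q "{x, y}"]
        by (auto simp: R_def)
      obtain C where C: "C \<subseteq> V"
        "\<And>a R. (\<Sum>w\<in>C. weight a (insert w R)) = weight a R + weight a (R \<union> {x, y})"
        by (rule merged_class_weight[OF True]) blast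
      have "weight a (insert w R) = 0" if "w \<in> C" for w
      proof (rule less.hyps)
        show "card (insert w R) < card Q" using R by (simp add: card_insert_if)
      qed (use R C that in auto)
      moreover have "weight a R = 0" using R by (intro less.hyps) auto
      ultimately show ?thesis using C(2)[of a R] R by simp
    qed
  qed
qed

text \<open>All members of \<open>cliques\<close> have the same size, so none properly contains
  another. Thus the coefficients can be read off from the weights.\<close>

lemma weight_clique:
  assumes "K \<in> cliques"
  shows "weight a K = a K"
proof -
  have "L = K" if "L \<in> cliques" "K \<subseteq> L" for L
  proof -
    have "card K = card L" using that assms by (simp add: cliques_def)
    then show ?thesis using card_subset_eq[OF finite_clique that(2)] that(1) by simp
  qed
  then have "{L. L \<in> cliques \<and> K \<subseteq> L} = {K}" using assms by blast
  then show ?thesis by (simp add: weight_def)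
qed

section \<open>Vertex sets on which the vanishing of weights is automatic\<close>

text \<open>Summing over all vertices gives h F = |P| F, and |P| < h forces F = 0.\<close>

lemma weight_vanishes_if_constant_on:
  assumes "P \<subseteq> V" "card P < h"
    and "\<And>v. v \<in> V - P \<Longrightarrow> weight a {v} = 0" "\<And>p. p \<in> P \<Longrightarrow> weight a {p} = weight a {}"
    and "v \<in> V"
  shows "weight a {v} = 0"
proof -
  have "real h * weight a {} = (\<Sum>v\<in>P. weight a {v})"
    unfolding sum_weight_singletons[symmetric]
    using assms finite_V by (intro sum.mono_neutral_right) auto
  also have "\<dots> = real (card P) * weight a {}" using assms(4) by simp
  finally have "weight a {} = 0" using assms(2) by simp
  then show ?thesis using assms by (cases "v \<in> P") auto
qed

text \<open>Otherwise \<open>v\<close> and its neighbours are h + 1 pairwise adjacent vertices. Some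
  vertex lies outside them, and deleting it leaves a graph that has an \<open>h\<close>-colouring,
  which is impossible.\<close>

lemma exists_nonadjacent_neighbours:
  assumes "v \<in> V" "card (neighbours v) = h" "card V > Suc h"
  shows "\<exists>x y. adj v x \<and> adj v y \<and> x \<noteq> y \<and> \<not> adj x y"
proof (rule ccontr)
  let ?M = "insert v (neighbours v)"
  assume "\<not> ?thesis"
  then have complete: "adj u w" if "u \<in> ?M" "w \<in> ?M" "u \<noteq> w" for u w
    using that adj_sym by blast
  have M: "finite ?M" "card ?M = Suc h"
    using assms finite_neighbours adj_irrefl by simp_all
  then obtain z where z: "z \<in> V" "z \<notin> ?M"
    using assms(3) card_mono[of ?M V] by (metis not_less subsetI)
  obtain c where c: "c ` (V - {z}) \<subseteq> {..<h}"
    "\<And>u w. adj u w \<Longrightarrow> u \<noteq> z \<Longrightarrow> w \<noteq> z \<Longrightarrow> c u \<noteq> c w"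
    using vertex_colouring[OF z(1)] by blast
  have "inj_on c ?M" using c(2) complete z by (metis inj_onI)
  moreover have "c ` ?M \<subseteq> {..<h}" using c(1) z assms(1) neighbours_subset[of v] by blast
  ultimately show False using M card_inj_on_le[of c ?M "{..<h}"] by simp
qed

text \<open>In an \<open>h\<close>-colouring of the graph without \<open>v\<close>, the
  \<open>h\<close> neighbours of \<open>v\<close> receive each colour once. The class of a vertex p
  of \<open>P\<close> then meets every clique exactly once, even the cliques through
  \<open>v\<close>, which contain all of \<open>P\<close>.\<close>

lemma vanishing_set_of_low_vertex:
  assumes v: "v \<in> V" "card (neighbours v) = h" and "card V > Suc h" "h \<ge> 2"
  obtains P where "P \<subseteq> V" "card P = h - 2"
    "\<And>a u. (\<And>w. w \<in> V - P \<Longrightarrow> weight a {w} = 0) \<Longrightarrow> u \<in> V \<Longrightarrow> weight a {u} = 0"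
proof -
  let ?N = "neighbours v"
  obtain c where c: "c ` (V - {v}) \<subseteq> {..<h}"
    "\<And>u w. adj u w \<Longrightarrow> u \<noteq> v \<Longrightarrow> w \<noteq> v \<Longrightarrow> c u \<noteq> c w"
    using vertex_colouring[OF v(1)] by blast
  \<comment> \<open>A colour absent from the neighbourhood could be given to \<open>v\<close>,
    extending the colouring to the whole graph.\<close>
  have "i \<in> c ` ?N" if "i < h" for i
  proof (rule ccontr)
    assume i: "i \<notin> c ` ?N"
    have "(c(v := i)) ` V \<subseteq> {..<h}" using c(1) that by auto
    from not_colourable[OF this] obtain u w where "adj u w" "(c(v := i)) u = (c(v := i)) w" by blast
    then show False using c(2)[of u w] i adj_sym adj_irrefl by (auto split: if_splits)
  qed
  then have onto: "c ` ?N = {..<h}" using c(1) neighbours_subset[of v] by blast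
  then have inj: "inj_on c ?N"
    using v(2) finite_neighbours by (intro eq_card_imp_inj_on) auto
  obtain x y where xy: "adj v x" "adj v y" "x \<noteq> y" "\<not> adj x y"
    using exists_nonadjacent_neighbours v assms(3) by blast
  define P where "P = ?N - {x, y}"
  have P: "P \<subseteq> V" "P \<subseteq> ?N" "card P = h - 2"
    using neighbours_subset[of v] xy v(2) finite_neighbours card_Diff_subset[of "{x, y}" ?N]
    by (auto simp: P_def)
  have "weight a {u} = 0" if off: "\<And>w. w \<in> V - P \<Longrightarrow> weight a {w} = 0" and u: "u \<in> V" for a u
  proof (rule weight_vanishes_if_constant_on[OF P(1) _ off _ u])
    show "card P < h" using P assms(4) by simp
    fix p assume p: "p \<in> P"
    define C where "C = {w \<in> V - {v}. c w = c p}"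
    have "finite C" using finite_V by (simp add: C_def)
    have pC: "p \<in> C" using p P neighbours_subset[of v] by (auto simp: C_def)
    have "card (K \<inter> C) = 1" if K: "K \<in> cliques" for K
    proof (cases "v \<in> K")
      case False
      have "bij_betw c K {..<h}"
      proof (rule rainbow_cliqueI[OF K])
        show "c ` K \<subseteq> {..<h}" using K False c(1) by (auto simp: cliques_def)
        show "c u \<noteq> c w" if "u \<in> K" "w \<in> K" "u \<noteq> w" for u w
          using c(2)[of u w] K that False by (auto simp: cliques_def)
      qed
      moreover have "c p \<in> {..<h}" using onto p P by auto
      moreover have "K \<inter> C = {w \<in> K. c w = c p}" using K False by (auto simp: C_def cliques_def)
      ultimately show ?thesis using card_fibre_eq_1[of c K "{..<h}" "c p"] by auto
    next
      case True
      have KN: "K - {v} \<subseteq> ?N" using K True by (auto simp: cliques_def)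
      \<comment> \<open>\<open>K\<close> minus \<open>v\<close> has h - 1 of the \<open>h\<close>
        neighbours, so it misses just one. That one is \<open>x\<close> or \<open>y\<close>, since
        these are not adjacent, and so it is not \<open>p\<close>.\<close>
      have "p \<in> K"
      proof (rule ccontr)
        assume "p \<notin> K"
        have "\<not> (x \<in> K \<and> y \<in> K)" using K xy by (auto simp: cliques_def)
        then obtain q where "q \<in> {x, y}" "q \<notin> K" by blast
        then have "K - {v} \<subseteq> ?N - {p, q}" "p \<noteq> q" "{p, q} \<subseteq> ?N"
          using KN \<open>p \<notin> K\<close> p xy by (auto simp: P_def)
        then have "card (K - {v}) \<le> h - 2"
          using card_mono[of "?N - {p, q}" "K - {v}"] card_Diff_subset[of "{p, q}" ?N]
            finite_neighbours[of v] v(2) by auto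
        then show False using True K finite_clique[OF K] assms(4) by (simp add: cliques_def)
      qed
      have "K \<inter> C = {p}"
      proof
        show "K \<inter> C \<subseteq> {p}"
        proof
          fix w assume "w \<in> K \<inter> C"
          then have "w \<in> ?N" "c w = c p" using KN by (auto simp: C_def)
          then show "w \<in> {p}" using inj p P by (auto dest: inj_onD)
        qed
      qed (use \<open>p \<in> K\<close> pC in auto)
      then show ?thesis by simp
    qed
    then have "(\<Sum>w\<in>C. weight a {w}) = weight a {}"
      using sum_weight_insert[OF \<open>finite C\<close>, of a "{}"] by (simp add: weight_def)
    \<comment> \<open>Colours are distinct on the neighbourhood, so \<open>p\<close> is the only
      member of \<open>C\<close> in \<open>P\<close>; the others have weight 0 by
      \<open>off\<close>.\<close>
    moreover have "(\<Sum>w\<in>C. weight a {w}) = (\<Sum>w\<in>{p}. weight a {w})"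
    proof (rule sum.mono_neutral_right)
      show "\<forall>w\<in>C - {p}. weight a {w} = 0"
      proof
        fix w assume w: "w \<in> C - {p}"
        then have "w \<notin> P" using inj p P by (auto simp: C_def dest: inj_onD)
        then show "weight a {w} = 0" using w off by (auto simp: C_def)
      qed
    qed (use \<open>finite C\<close> pC in auto)
    ultimately show "weight a {p} = weight a {}" by simp
  qed
  with that P show thesis by blast
qed

text \<open>Evaluating the weights of the edges at p through merged classes and summing them gives
  (deg p - h)(f(p) - F) = 0, and the degree condition cancels the first factor.\<close>

lemma clique_is_vanishing_set:
  assumes P: "P \<subseteq> V" "card P < h" "\<And>p q. p \<in> P \<Longrightarrow> q \<in> P \<Longrightarrow> p \<noteq> q \<Longrightarrow> adj p q"
    and degrees: "\<And>p. p \<in> P \<Longrightarrow> card (neighbours p) \<noteq> h"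
    and off: "\<And>w. w \<in> V - P \<Longrightarrow> weight a {w} = 0" and u: "u \<in> V"
  shows "weight a {u} = 0"
proof (rule weight_vanishes_if_constant_on[OF P(1,2) off _ u])
  fix p assume p: "p \<in> P"
  let ?F = "weight a {}" and ?f = "\<lambda>v. weight a {v}"
  have fin: "finite P" using P(1) finite_V by (rule finite_subset)
  have edge: "weight a {w, p} = ?f p + (if w \<in> P then ?f w else 0) - ?F" if pw: "adj p w" for w
  proof -
    obtain C where C: "C \<subseteq> V" "p \<in> C" "w \<in> C"
      "\<And>u v. u \<in> C \<Longrightarrow> v \<in> C \<Longrightarrow> adj u v \<Longrightarrow> {u, v} = {p, w}"
      "\<And>a R. (\<Sum>w\<in>C. weight a (insert w R)) = weight a R + weight a (R \<union> {p, w})"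
      by (rule merged_class_weight[OF pw]) blast
    \<comment> \<open>Any other vertex of \<open>P\<close> in \<open>C\<close> would be adjacent to
      \<open>p\<close>, but pw is the only edge inside \<open>C\<close>. Hence only
      \<open>p\<close>, and \<open>w\<close> if it lies in \<open>P\<close>, contribute to the class
      sum.\<close>
    have "C \<inter> P = {p, w} \<inter> P"
    proof
      show "C \<inter> P \<subseteq> {p, w} \<inter> P"
      proof
        fix q assume "q \<in> C \<inter> P"
        then show "q \<in> {p, w} \<inter> P"
          using C(4)[of p q] C(2) P(3)[OF p, of q] by (cases "q = p") (auto simp: doubleton_eq_iff)
      qed
    qed (use C in auto)
    moreover have "(\<Sum>v\<in>C. ?f v) = (\<Sum>v\<in>C \<inter> P. ?f v)"
      using C(1) finite_V off by (intro sum.mono_neutral_right) (auto intro: finite_subset)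
    ultimately have "?F + weight a {p, w} = (\<Sum>v\<in>{p, w} \<inter> P. ?f v)"
      using C(5)[of a "{}"] by simp
    moreover have "p \<noteq> w" using pw adj_irrefl by blast
    ultimately show ?thesis using p by (auto simp: insert_commute Int_insert_left)
  qed
  have "(real h - 1) * ?f p = (\<Sum>w\<in>neighbours p. ?f p + (if w \<in> P then ?f w else 0) - ?F)"
    unfolding sum_weight_neighbours[symmetric] using edge by (intro sum.cong) auto
  also have "\<dots> = real (card (neighbours p)) * (?f p - ?F) + (\<Sum>w\<in>neighbours p. if w \<in> P then ?f w else 0)"
    by (simp add: sum.distrib sum_subtractf algebra_simps)
  also have "(\<Sum>w\<in>neighbours p. if w \<in> P then ?f w else 0) = (\<Sum>w\<in>{w \<in> neighbours p. w \<in> P}. ?f w)"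
    using finite_neighbours by (simp only: sum.inter_filter)
  also have "{w \<in> neighbours p. w \<in> P} = P - {p}" using P(3) p adj_irrefl by auto
  also have "(\<Sum>w\<in>P - {p}. ?f w) = (\<Sum>w\<in>P. ?f w) - ?f p" using fin p by (simp add: sum_diff1)
  \<comment> \<open>Weights vanish off \<open>P\<close>, so the sum over \<open>P\<close> is the
    known total h F.\<close>
  also have "(\<Sum>w\<in>P. ?f w) = (\<Sum>w\<in>V. ?f w)"
    using P(1) finite_V off by (intro sum.mono_neutral_left) auto
  also have "\<dots> = real h * ?F" by (rule sum_weight_singletons)
  finally have "(real (card (neighbours p)) - real h) * (?f p - ?F) = 0"
    by (simp add: algebra_simps)
  then show "?f p = ?F" using degrees[OF p] by simp
qed

section \<open>The dimension count\<close>

theorem card_cliques_le: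
  assumes "h \<ge> 3" "card V > Suc h"
  shows "card cliques + (h - 2) \<le> card V"
proof (cases "cliques = {}")
  case True
  then show ?thesis using assms by simp
next
  case False
  \<comment> \<open>If no vertex has degree \<open>h\<close>, the set \<open>P\<close> is chosen
    inside this clique.\<close>
  then obtain K where K: "K \<in> cliques" by blast
  obtain P where P: "P \<subseteq> V" "card P = h - 2"
    "\<And>a u. (\<And>w. w \<in> V - P \<Longrightarrow> weight a {w} = 0) \<Longrightarrow> u \<in> V \<Longrightarrow> weight a {u} = 0"
  proof (cases "\<exists>v\<in>V. card (neighbours v) = h")
    case True
    then obtain v where "v \<in> V" "card (neighbours v) = h" by blast
    then show thesis using vanishing_set_of_low_vertex[of v] assms that by auto
  next
    case False
    obtain P where P: "P \<subseteq> K" "card P = h - 2"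
      by (rule obtain_subset_with_card_n[of "h - 2" K]) (use K in \<open>auto simp: cliques_def\<close>)
    have "P \<subseteq> V" using P K by (auto simp: cliques_def)
    moreover have "weight a {u} = 0" if "\<And>w. w \<in> V - P \<Longrightarrow> weight a {w} = 0" "u \<in> V" for a u
    proof (rule clique_is_vanishing_set[OF \<open>P \<subseteq> V\<close> _ _ _ that])
      show "adj p q" if "p \<in> P" "q \<in> P" "p \<noteq> q" for p q
        using that P K by (auto simp: cliques_def)
    qed (use P False assms(1) \<open>P \<subseteq> V\<close> in auto)
    ultimately show thesis using that P by blast
  qed
  have "card cliques \<le> card (V - P)"
  proof (rule ccontr)
    assume "\<not> ?thesis"
    then have "card (V - P) < card cliques" by simp
    \<comment> \<open>One unknown per clique and one equation per vertex outside \<open>P\<close>,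
      saying that its weight is 0. By the choice of \<open>P\<close> a solution has weight 0 at
      every vertex, hence on every clique, so it is trivial.\<close>
    from homogeneous_system_nontrivial[OF finite_Diff[OF finite_V] finite_cliques this,
        of "\<lambda>v K. if v \<in> K then 1 else 0"]
    obtain a :: "'a set \<Rightarrow> real" where a: "\<exists>K\<in>cliques. a K \<noteq> 0"
      "\<And>v. v \<in> V - P \<Longrightarrow> (\<Sum>K\<in>cliques. (if v \<in> K then 1 else 0) * a K) = 0"
      by blast
    have "weight a {v} = 0" if "v \<in> V - P" for v
    proof -
      have "weight a {v} = (\<Sum>K\<in>{K\<in>cliques. v \<in> K}. a K)"
        by (simp add: weight_def)
      also have "\<dots> = (\<Sum>K\<in>cliques. if v \<in> K then a K else 0)"
        using finite_cliques by (simp only: sum.inter_filter)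
      also have "\<dots> = (\<Sum>K\<in>cliques. (if v \<in> K then 1 else 0) * a K)"
        by (intro sum.cong) auto
      finally show ?thesis using a(2)[OF that] by simp
    qed
    then have "weight a {v} = 0" if "v \<in> V" for v using P(3) that by blast
    then have "a L = 0" if "L \<in> cliques" for L
      using weight_eq_0[of a L] weight_clique[OF that, of a] that assms(1) finite_clique[OF that]
      by (auto simp: cliques_def)
    with a(1) show False by blast
  qed
  moreover have "card (V - P) = card V - (h - 2)"
    using P finite_V by (metis card_Diff_subset finite_subset)
  moreover have "h - 2 \<le> card V" using P finite_V card_mono by metis
  ultimately show ?thesis by linarith
qed

end

section \<open>From critical digraphs to \<open>critical_adjacency\<close>\<close>

text \<open>The minimum is attained once some colouring exists; an injective numbering of the
  vertices is one.\<close>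

lemma proper_colouring_chromatic_number:
  assumes "finite (verts G)" "\<And>v. \<not> v \<rightarrow>\<^bsub>G\<^esub> v" "wf_digraph G"
  shows "\<exists>c. proper_colouring G (chromatic_number G) c"
proof -
  obtain c where c: "bij_betw c (verts G) {0..<card (verts G)}"
    using ex_bij_betw_finite_nat[OF assms(1)] by blast
  have "c u \<noteq> c v" if "u \<rightarrow>\<^bsub>G\<^esub> v" for u v
  proof -
    have "u \<in> verts G" "v \<in> verts G"
      using that assms(3) by (auto simp: arcs_ends_conv wf_digraph_def)
    moreover have "u \<noteq> v" using that assms(2) by blast
    ultimately show ?thesis using c by (auto simp: bij_betw_def dest: inj_onD)
  qed
  then have "proper_colouring G (card (verts G)) c"
    using c by (auto simp: proper_colouring_def bij_betw_def)
  then have "\<exists>c. proper_colouring G (card (verts G)) c" by blast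
  then show ?thesis unfolding chromatic_number_def by (rule LeastI)
qed

text \<open>\<open>W\<close> and the symmetric relation \<open>R\<close> select the vertices and
  edges of a subgraph, so that edge and vertex deletion are handled at once. It is proper, so its
  chromatic number is at most k - 1.\<close>

lemma critical_proper_subgraph_colouring:
  assumes "critical k G"
    and "W \<subseteq> verts G" "\<And>u v. R u v \<Longrightarrow> R v u" "\<And>u v. R u v \<Longrightarrow> u \<in> W"
    and "W \<noteq> verts G \<or> (\<exists>u v. u \<rightarrow>\<^bsub>G\<^esub> v \<and> \<not> R u v)"
  shows "\<exists>c. c ` W \<subseteq> {..<k - 1} \<and> (\<forall>u v. u \<rightarrow>\<^bsub>G\<^esub> v \<longrightarrow> R u v \<longrightarrow> c u \<noteq> c v)"
proof -
  from assms(1) interpret graph G by (simp add: critical_def)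
  define H where "H = \<lparr>verts = W, arcs = {e \<in> arcs G. R (tail G e) (head G e)},
    tail = tail G, head = head G\<rparr>"
  have ends: "u \<rightarrow>\<^bsub>H\<^esub> v \<longleftrightarrow> u \<rightarrow>\<^bsub>G\<^esub> v \<and> R u v" for u v
    by (auto simp: H_def arcs_ends_conv)
  have "graph H"
  proof
    show "finite (verts H)" using assms(2) by (auto simp: H_def intro: finite_subset)
    show "symmetric H"
      using ends assms(3) arcs_ends_symmetric[OF sym_arcs] by (auto simp: symmetric_def intro!: symI)
  qed (use assms(3,4) no_loops no_multi_arcs in \<open>auto simp: H_def arc_to_ends_def\<close>)
  then interpret H: graph H .
  have "subgraph H G"
    using H.wf_digraph wf_digraph assms(2) by (auto simp: subgraph_def compatible_def H_def)
  moreover have "H \<noteq> G"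
  proof
    assume "H = G"
    moreover have "verts H = W" by (simp add: H_def)
    ultimately have "W = verts G" by simp
    with assms(5) obtain u v where "u \<rightarrow>\<^bsub>G\<^esub> v" "\<not> R u v" by blast
    with ends[of u v] \<open>H = G\<close> show False by simp
  qed
  ultimately have "chromatic_number H < k"
    using assms(1) \<open>graph H\<close> by (simp add: critical_def)
  moreover obtain c where "proper_colouring H (chromatic_number H) c"
    using proper_colouring_chromatic_number[of H] H.finite_verts H.adj_not_same H.wf_digraph by blast
  ultimately show ?thesis
    using ends by (intro exI[of _ c]) (fastforce simp: proper_colouring_def H_def)
qed

lemma critical_adjacency_critical:
  assumes "critical k G" "k \<ge> 1"
  shows "critical_adjacency (verts G) (\<lambda>u v. u \<rightarrow>\<^bsub>G\<^esub> v) (k - 1)"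
proof -
  from assms(1) interpret graph G by (simp add: critical_def)
  have in_verts: "u \<in> verts G \<and> v \<in> verts G" if "u \<rightarrow>\<^bsub>G\<^esub> v" for u v
    using that by (auto simp: arcs_ends_conv)
  show ?thesis
  proof
    show "finite (verts G)" by simp
    show "u \<in> verts G" if "u \<rightarrow>\<^bsub>G\<^esub> v" for u v using in_verts[OF that] by simp
    show "v \<rightarrow>\<^bsub>G\<^esub> u" if "u \<rightarrow>\<^bsub>G\<^esub> v" for u v using that sym_arcs by (rule arcs_ends_symmetric[rotated])
    show "\<not> u \<rightarrow>\<^bsub>G\<^esub> u" for u using adj_not_same by blast
    show "\<exists>c. c ` verts G \<subseteq> {..<k - 1} \<and> (\<forall>u v. u \<rightarrow>\<^bsub>G\<^esub> v \<longrightarrow> {u, v} \<noteq> {x, y} \<longrightarrow> c u \<noteq> c v)"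
      if "x \<rightarrow>\<^bsub>G\<^esub> y" for x y
    proof -
      have "\<exists>c. c ` verts G \<subseteq> {..<k - 1} \<and> (\<forall>u v. u \<rightarrow>\<^bsub>G\<^esub> v \<longrightarrow>
          (u \<in> verts G \<and> v \<in> verts G \<and> {u, v} \<noteq> {x, y}) \<longrightarrow> c u \<noteq> c v)"
        using that by (intro critical_proper_subgraph_colouring[OF assms(1)]) (auto simp: insert_commute)
      then show ?thesis using in_verts by metis
    qed
    show "\<exists>c. c ` (verts G - {z}) \<subseteq> {..<k - 1} \<and>
        (\<forall>u v. u \<rightarrow>\<^bsub>G\<^esub> v \<longrightarrow> u \<noteq> z \<longrightarrow> v \<noteq> z \<longrightarrow> c u \<noteq> c v)"
      if "z \<in> verts G" for z
    proof -
      have "\<exists>c. c ` (verts G - {z}) \<subseteq> {..<k - 1} \<and> (\<forall>u v. u \<rightarrow>\<^bsub>G\<^esub> v \<longrightarrow>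
          (u \<in> verts G - {z} \<and> v \<in> verts G - {z}) \<longrightarrow> c u \<noteq> c v)"
        using that by (intro critical_proper_subgraph_colouring[OF assms(1)]) auto
      then show ?thesis using in_verts by (metis DiffI singletonD)
    qed
    show "\<exists>u v. u \<rightarrow>\<^bsub>G\<^esub> v \<and> c u = c v" if "c ` verts G \<subseteq> {..<k - 1}" for c
    proof (rule ccontr)
      assume "\<not> ?thesis"
      then have "\<exists>c. proper_colouring G (k - 1) c"
        using that by (auto simp: proper_colouring_def)
      then have "chromatic_number G \<le> k - 1"
        unfolding chromatic_number_def by (rule Least_le)
      \<comment> \<open>Here \<open>k \<ge> 1\<close> ensures that \<open>k - 1\<close> is really
        below \<open>k\<close>.\<close>
      then show False using assms by (simp add: critical_def)
    qed
  qed
qed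

text \<open>A complete subgraph is determined by its vertex set, so \<open>verts\<close> maps the
  counted subgraphs injectively to vertex sets of cliques.\<close>

lemma (in graph) clique_count_le:
  "clique_count l G \<le>
    card {K. K \<subseteq> verts G \<and> card K = l \<and> (\<forall>u\<in>K. \<forall>v\<in>K. u \<noteq> v \<longrightarrow> u \<rightarrow>\<^bsub>G\<^esub> v)}"
proof -
  let ?A = "{H. subgraph H G \<and> complete_digraph l H}"
  have ends: "u \<rightarrow>\<^bsub>H\<^esub> v \<longleftrightarrow> u \<in> verts H \<and> v \<in> verts H \<and> u \<noteq> v" if "H \<in> ?A" for H u v
    using that by (auto simp: complete_digraph_def)
  have sub: "tail H = tail G" "head H = head G" "arcs H \<subseteq> arcs G" "verts H \<subseteq> verts G"
    if "H \<in> ?A" for H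
    using that by (auto simp: subgraph_def compatible_def)
  have arcs: "arcs H = {e \<in> arcs G. tail G e \<in> verts H \<and> head G e \<in> verts H}" if H: "H \<in> ?A" for H
  proof
    show "arcs H \<subseteq> {e \<in> arcs G. tail G e \<in> verts H \<and> head G e \<in> verts H}"
      using H sub[OF H] by (auto simp: subgraph_def wf_digraph_def)
    \<comment> \<open>Completeness of \<open>H\<close> yields an arc with the same ends as
      \<open>e\<close>, and without parallel arcs in \<open>G\<close> it is \<open>e\<close>
      itself.\<close>
    show "{e \<in> arcs G. tail G e \<in> verts H \<and> head G e \<in> verts H} \<subseteq> arcs H"
    proof
      fix e assume e: "e \<in> {e \<in> arcs G. tail G e \<in> verts H \<and> head G e \<in> verts H}"
      then have "tail G e \<rightarrow>\<^bsub>H\<^esub> head G e" using ends[OF H] no_loops by auto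
      then obtain e' where "e' \<in> arcs H" "tail H e' = tail G e" "head H e' = head G e" by blast
      then show "e \<in> arcs H"
        using no_multi_arcs[of e' e] e sub[OF H] by (auto simp: arc_to_ends_def)
    qed
  qed
  have "inj_on verts ?A"
  proof (rule inj_onI)
    fix H H' assume "H \<in> ?A" "H' \<in> ?A" "verts H = verts H'"
    then show "H = H'" using arcs[of H] arcs[of H'] sub[of H] sub[of H'] by simp
  qed
  moreover have "verts ` ?A \<subseteq>
      {K. K \<subseteq> verts G \<and> card K = l \<and> (\<forall>u\<in>K. \<forall>v\<in>K. u \<noteq> v \<longrightarrow> u \<rightarrow>\<^bsub>G\<^esub> v)}"
  proof safe
    fix H u v assume H: "subgraph H G" "complete_digraph l H" and "u \<in> verts H" "v \<in> verts H" "u \<noteq> v"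
    then have "u \<rightarrow>\<^bsub>H\<^esub> v" using ends[of H] by simp
    then show "u \<rightarrow>\<^bsub>G\<^esub> v" using H sub[of H] by (auto simp: arcs_ends_conv)
  qed (auto simp: subgraph_def complete_digraph_def)
  ultimately show ?thesis
    unfolding clique_count_def by (rule card_inj_on_le) simp
qed

theorem theorem2:
  fixes n k :: nat and G :: "('a, 'b) pre_digraph"
  assumes "k \<ge> 4" and "n > k"
    and "critical k G" and "card (verts G) = n"
  shows "clique_count (k - 1) G \<le> n - k + 3"
proof -
  interpret critical_adjacency "verts G" "\<lambda>u v. u \<rightarrow>\<^bsub>G\<^esub> v" "k - 1"
    using assms by (intro critical_adjacency_critical) simp_all
  interpret graph G using assms(3) by (simp add: critical_def)
  have "clique_count (k - 1) G \<le> card cliques"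
    unfolding cliques_def by (rule clique_count_le)
  \<comment> \<open>For h = k - 1, the size condition |V| > h + 1 is n > k, and n - (h - 2) is n - k
    + 3.\<close>
  moreover have "card cliques + (k - 1 - 2) \<le> n"
    using card_cliques_le assms by simp
  ultimately show ?thesis using assms by simp
qed

end
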